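(* Let $G=(V,E)$ be an infinite, locally finite, connected graph with heat kernel $p_t(x,y)$, and let $P_t\mathbf{1}(x)=\sum_{y\in V}p_t(x,y)$. Let $\lambda<0$ be any negative constant. Then the following statements are equivalent: 1) For some $t_0>0$ and some $x_0\in V$, $P_{t_0}\mathbf{1}(x_0)<1$. 1') For all $t>0$ and all $x\in V$, $P_t\mathbf{1}(x)<1$. 2) There exists a positive (equivalently, non-zero) bounded function $v$ on $G$ such that $\Delta v=\lambda v$. 2') There exists a positive (equivalently, non-zero) bounded function $v$ on $G$ such that $\Delta v\le\lambda v$. 3) There exists a nonzero, bounded solution $u$ to $$\Delta u(x,t)+\frac{\partial u}{\partial t}(x,t)=0 \ \text{ for all } x\in V,\ \text{all } t>0,\qquad u(x,0)=0\ \text{ for all } x\in V.$$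
   Context: For a vertex $x$, $y\sim x$ means that $x$ and $y$ are joined by an edge. A function on $G$ is a map $V\to\mathbf{R}$. The combinatorial Laplacian acts on functions $f:V\to\mathbf{R}$ by $\Delta f(x)=\sum_{y\sim x}(f(x)-f(y))$; for functions of $(x,t)$ it acts in $x$. The heat kernel $p_t(x,y)$ of $G$ is the smallest non-negative function $p:V\times V\times[0,\infty)\to[0,1]$ which is smooth in $t$, satisfies $\Delta p_t(x,y)+\frac{\partial}{\partial t}p_t(x,y)=0$ (with $\Delta$ acting in either $x$ or $y$) and $p_0(x,y)=\delta_x(y)$, where $\delta_x(y)=1$ if $x=y$ and $0$ otherwise; it always satisfies $\sum_{y\in V}p_t(x,y)\le1$. Solutions of the heat equation are, for each vertex, continuous in $t\in[0,\infty)$ and $C^1$ in $t\in(0,\infty)$.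
   Formalization: In 2'), "equivalently, non-zero" is read as "non-negative and not identically zero", since without a sign condition v = -1 satisfies Δv = 0 ≤ λv on every graph, including those where 1) fails, such as Z. *)

theory Defs
  imports "HOL-Analysis.Analysis"
begin

definition simple_graph :: "'a set \<Rightarrow> 'a set set \<Rightarrow> bool" where
  "simple_graph V E \<longleftrightarrow> (\<forall>e\<in>E. e \<subseteq> V \<and> card e = 2)"

definition adj :: "'a set set \<Rightarrow> 'a \<Rightarrow> 'a \<Rightarrow> bool" where
  "adj E x y \<longleftrightarrow> {x, y} \<in> E"

definition locally_finite_graph :: "'a set \<Rightarrow> 'a set set \<Rightarrow> bool" where
  "locally_finite_graph V E \<longleftrightarrow> (\<forall>x\<in>V. finite {y. adj E x y})"

definition connected_graph :: "'a set \<Rightarrow> 'a set set \<Rightarrow> bool" where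
  "connected_graph V E \<longleftrightarrow> (\<forall>x\<in>V. \<forall>y\<in>V. (adj E)\<^sup>*\<^sup>* x y)"

definition laplacian :: "'a set set \<Rightarrow> ('a \<Rightarrow> real) \<Rightarrow> 'a \<Rightarrow> real" where
  "laplacian E f x = (\<Sum>y | adj E x y. f x - f y)"

text \<open>Smoothness on the half-line; the derivatives at 0 are one-sided, and values at
  negative arguments are irrelevant.\<close>

definition smooth_on_nonneg :: "(real \<Rightarrow> real) \<Rightarrow> bool" where
  "smooth_on_nonneg f \<longleftrightarrow> (\<exists>D :: nat \<Rightarrow> real \<Rightarrow> real. D 0 = f \<and>
     (\<forall>n. \<forall>t\<ge>0. (D n has_real_derivative D (Suc n) t) (at t within {0..})))"

text \<open>The class of functions among which the heat kernel is the smallest one. A function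
  on \<open>V \<times> V \<times> [0,\<infinity>)\<close> is a total function \<open>p t x y\<close> of which only the values at
  \<open>t \<ge> 0\<close> and \<open>x, y \<in> V\<close> matter. The heat equation is required in each of the
  two space variables.\<close>

definition heat_kernel_candidate ::
    "'a set \<Rightarrow> 'a set set \<Rightarrow> (real \<Rightarrow> 'a \<Rightarrow> 'a \<Rightarrow> real) \<Rightarrow> bool" where
  "heat_kernel_candidate V E p \<longleftrightarrow>
     (\<forall>x\<in>V. \<forall>y\<in>V.
        (\<forall>t\<ge>0. p t x y \<in> {0..1}) \<and>
        smooth_on_nonneg (\<lambda>t. p t x y) \<and>
        (\<forall>t\<ge>0. ((\<lambda>s. p s x y) has_real_derivative - laplacian E (\<lambda>z. p t z y) x)
                 (at t within {0..})) \<and>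
        (\<forall>t\<ge>0. ((\<lambda>s. p s x y) has_real_derivative - laplacian E (\<lambda>z. p t x z) y)
                 (at t within {0..})) \<and>
        p 0 x y = (if x = y then 1 else 0))"

definition is_heat_kernel ::
    "'a set \<Rightarrow> 'a set set \<Rightarrow> (real \<Rightarrow> 'a \<Rightarrow> 'a \<Rightarrow> real) \<Rightarrow> bool" where
  "is_heat_kernel V E p \<longleftrightarrow> heat_kernel_candidate V E p \<and>
     (\<forall>q. heat_kernel_candidate V E q \<longrightarrow> (\<forall>t\<ge>0. \<forall>x\<in>V. \<forall>y\<in>V. p t x y \<le> q t x y))"

text \<open>By minimality the choice below is unique at \<open>t \<ge> 0\<close> and \<open>x, y \<in> V\<close>. It is not
  unique elsewhere, hence no definite description.\<close>

definition heat_kernel :: "'a set \<Rightarrow> 'a set set \<Rightarrow> real \<Rightarrow> 'a \<Rightarrow> 'a \<Rightarrow> real" where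
  "heat_kernel V E = (SOME p. is_heat_kernel V E p)"

text \<open>The function \<open>P\<^sub>t 1\<close>. The family is summable because the heat kernel satisfies
  \<open>\<Sum>\<^sub>y p t x y \<le> 1\<close>, so the convention that a non-summable \<open>infsum\<close> is 0 plays
  no role.\<close>

definition heat_semigroup_one :: "'a set \<Rightarrow> 'a set set \<Rightarrow> real \<Rightarrow> 'a \<Rightarrow> real" where
  "heat_semigroup_one V E t x = (\<Sum>\<^sub>\<infinity>y\<in>V. heat_kernel V E t x y)"

definition heat_solution :: "'a set \<Rightarrow> 'a set set \<Rightarrow> ('a \<Rightarrow> real \<Rightarrow> real) \<Rightarrow> bool" where
  "heat_solution V E u \<longleftrightarrow>
     (\<forall>x\<in>V. continuous_on {0..} (u x) \<and> u x C1_differentiable_on {0<..} \<and>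
        (\<forall>t>0. laplacian E (\<lambda>y. u y t) x + deriv (u x) t = 0))"

text \<open>For the differential inequality, being non-zero alone is not enough: the constant
  \<open>-1\<close> satisfies it on every graph. A non-zero function in that context is therefore
  understood to be non-negative.\<close>

lemma minus_one_subsolution:
  assumes "c \<le> 0"
  shows "laplacian E (\<lambda>_. - 1) x \<le> c * (- 1)"
  using assms by (simp add: laplacian_def)

end

theory Submission
  imports Defs
begin

text \<open>
  The heat kernel is constructed as the increasing limit of the Dirichlet heat kernels of finite
  balls, each of which is the exponential series of a finite matrix; the parabolic minimum
  principle on finite sets gives monotonicity and minimality. The same limit for the total mass
  shows that the defect \<open>h = 1 - P\<^sub>t 1\<close> solves the heat equation, starts at 0, is
  nondecreasing in time and dominates every solution bounded above by 1 with zero initial values.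
  A zero of \<open>h\<close> at a positive time therefore spreads first over the connected graph and then over
  all times, which gives (1') from (1), and (3) is the statement that \<open>h\<close> is nonzero. The function
  of (2) is the Laplace transform \<open>\<integral> - \<lambda> exp (\<lambda> t) h dt\<close>. Conversely, if \<open>0 \<le> v \<le> 1\<close> and
  \<open>\<Delta> v \<le> \<lambda> v\<close>, then \<open>exp (- \<lambda> t) v\<close> is a subsolution, which comparison bounds by
  \<open>1 + exp (- \<lambda> T) h\<close> up to time \<open>T\<close>; if \<open>h = 0\<close>, this fails for large \<open>T\<close>.
\<close>

section \<open>The graph with a base vertex, and elementary facts on the Laplacian\<close>

locale lfc_graph =
  fixes V :: "'a set" and E :: "'a set set" and root :: 'a
  assumes simple: "simple_graph V E"
    and locally_finite: "locally_finite_graph V E"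
    and connected: "connected_graph V E"
    and root_in: "root \<in> V"
begin

lemma adj_sym: "adj E x y \<longleftrightarrow> adj E y x"
  by (simp add: adj_def insert_commute)

lemma adj_in: "adj E x y \<Longrightarrow> y \<in> V"
  using simple by (auto simp: adj_def simple_graph_def)

lemma finite_nbrs: "x \<in> V \<Longrightarrow> finite {y. adj E x y}"
  using locally_finite by (auto simp: locally_finite_graph_def)

lemma laplacian_diff:
  "laplacian E (\<lambda>y. f y - g y) x = laplacian E f x - laplacian E g x"
  unfolding laplacian_def by (simp add: sum_subtractf[symmetric] algebra_simps)

lemma laplacian_add:
  "laplacian E (\<lambda>y. f y + g y) x = laplacian E f x + laplacian E g x"
  unfolding laplacian_def by (simp add: sum.distrib[symmetric] algebra_simps)

lemma laplacian_const: "laplacian E (\<lambda>y. c) x = 0"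
  by (simp add: laplacian_def)

lemma laplacian_mult: "laplacian E (\<lambda>y. c * f y) x = c * laplacian E f x"
  unfolding laplacian_def by (simp add: sum_distrib_left algebra_simps)

lemma laplacian_sum:
  "laplacian E (\<lambda>y. \<Sum>i\<in>I. f i y) x = (\<Sum>i\<in>I. laplacian E (f i) x)"
  unfolding laplacian_def by (subst sum.swap) (simp add: sum_subtractf)

lemma laplacian_abs_le:
  fixes M :: real
  assumes "x \<in> V" "\<And>y. y \<in> V \<Longrightarrow> \<bar>f y\<bar> \<le> M"
  shows "\<bar>laplacian E f x\<bar> \<le> 2 * real (card {y. adj E x y}) * M"
proof -
  have "\<bar>laplacian E f x\<bar> \<le> (\<Sum>y | adj E x y. \<bar>f x - f y\<bar>)"
    unfolding laplacian_def by (rule sum_abs)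
  also have "\<dots> \<le> (\<Sum>y\<in>{y. adj E x y}. 2 * M)"
  proof (rule sum_mono)
    fix y assume "y \<in> {y. adj E x y}"
    then have "y \<in> V" using adj_in by auto
    then show "\<bar>f x - f y\<bar> \<le> 2 * M" using assms(2)[of x] assms(2)[of y] assms(1) by linarith
  qed
  finally show ?thesis by simp
qed

lemma laplacian_nonpos_at_min:
  assumes "\<And>y. y \<in> V \<Longrightarrow> f x \<le> f y"
  shows "laplacian E f x \<le> 0"
  unfolding laplacian_def using assms adj_in by (intro sum_nonpos) auto

lemma laplacian_tendsto:
  assumes "x \<in> V" "\<And>y. y \<in> V \<Longrightarrow> ((\<lambda>n. f n y) \<longlongrightarrow> g y) F"
  shows "((\<lambda>n. laplacian E (f n) x) \<longlongrightarrow> laplacian E g x) F"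
  unfolding laplacian_def using assms adj_in by (intro tendsto_sum tendsto_diff) auto

lemma laplacian_continuous:
  assumes "x \<in> V" "\<And>y. y \<in> V \<Longrightarrow> continuous_on S (\<lambda>t. f y t)"
  shows "continuous_on S (\<lambda>t. laplacian E (\<lambda>y. f y t) x)"
  unfolding laplacian_def using assms adj_in by (intro continuous_intros) auto

lemma laplacian_deriv:
  assumes "x \<in> V" "\<And>y. y \<in> V \<Longrightarrow> ((\<lambda>t. f y t) has_real_derivative f' y) F"
  shows "((\<lambda>t. laplacian E (\<lambda>y. f y t) x) has_real_derivative laplacian E f' x) F"
  unfolding laplacian_def using assms adj_in by (intro DERIV_sum derivative_intros) auto

text \<open>At a zero of a non-negative function the Laplacian is minus the sum of the neighbouring
  values. If it is also non-negative, each of these values is 0, and connectedness carries the zero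
  along paths.\<close>

lemma vanishing_propagates:
  assumes nonneg: "\<And>x. x \<in> V \<Longrightarrow> f x \<ge> 0"
    and step: "\<And>x. x \<in> V \<Longrightarrow> f x = 0 \<Longrightarrow> laplacian E f x \<ge> 0"
    and x: "x \<in> V" "f x = 0" and y: "y \<in> V"
  shows "f y = 0"
proof -
  have nb: "f b = 0" if a: "a \<in> V" "f a = 0" and ab: "adj E a b" for a b
  proof -
    have "(\<Sum>y | adj E a y. f y) \<le> 0"
      using step[OF a] a(2) by (simp add: laplacian_def sum_negf)
    moreover have "(\<Sum>y | adj E a y. f y) \<ge> f b"
      using ab nonneg adj_in by (intro member_le_sum finite_nbrs a) auto
    ultimately show ?thesis using nonneg[OF adj_in[OF ab]] by linarith
  qed
  have "(adj E)\<^sup>*\<^sup>* x y"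
    using connected x y by (auto simp: connected_graph_def)
  then have "y \<in> V \<and> f y = 0"
    by induction (use x nb adj_in in auto)
  then show ?thesis by simp
qed

section \<open>Exhaustion by finite balls about \<open>root\<close>, and the parabolic minimum
  principle\<close>

primrec ball_set :: "nat \<Rightarrow> 'a set" where
  "ball_set 0 = {root}"
| "ball_set (Suc n) = ball_set n \<union> (\<Union>x\<in>ball_set n. {y. adj E x y})"

lemma ball_set_subset: "ball_set n \<subseteq> V"
  by (induction n) (use root_in adj_in in auto)

lemma ball_set_finite: "finite (ball_set n)"
  by (induction n) (use finite_nbrs ball_set_subset in auto)

lemma ball_set_mono: "m \<le> n \<Longrightarrow> ball_set m \<subseteq> ball_set n"
  by (rule lift_Suc_mono_le[of ball_set]) auto

lemma ball_set_exhausts: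
  assumes "x \<in> V"
  shows "eventually (\<lambda>n. x \<in> ball_set n) sequentially"
proof -
  have "(adj E)\<^sup>*\<^sup>* root x"
    using connected root_in assms by (auto simp: connected_graph_def)
  then have "\<exists>n. x \<in> ball_set n"
  proof induction
    case base
    show ?case by (rule exI[of _ 0]) simp
  next
    case (step y z)
    then obtain n where "y \<in> ball_set n" by blast
    then have "z \<in> ball_set (Suc n)" using step by auto
    then show ?case by blast
  qed
  then obtain n where "x \<in> ball_set n" by blast
  then show ?thesis
    using ball_set_mono by (auto simp: eventually_sequentially)
qed

text \<open>A negative value would give a tilted function a negative minimum over \<open>D\<close>
  and \<open>[0, t]\<close>. There the time derivative of \<open>g\<close> is at most
  \<open>- e\<close> and the Laplacian is at most 0, against the hypothesis that their sum is
  non-negative. The sign condition outside \<open>D\<close> takes the place of boundary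
  values.\<close>

lemma parabolic_minimum_principle:
  assumes D: "finite D" "D \<subseteq> V"
    and cont: "\<And>x. x \<in> D \<Longrightarrow> continuous_on {0..T} (g x)"
    and init: "\<And>x. x \<in> D \<Longrightarrow> g x 0 \<ge> 0"
    and outside: "\<And>x t. x \<in> V - D \<Longrightarrow> 0 \<le> t \<Longrightarrow> t \<le> T \<Longrightarrow> g x t \<ge> 0"
    and deriv: "\<And>x t. x \<in> D \<Longrightarrow> 0 < t \<Longrightarrow> t \<le> T \<Longrightarrow> (g x has_real_derivative g' x t) (at t)"
    and super: "\<And>x t. x \<in> D \<Longrightarrow> 0 < t \<Longrightarrow> t \<le> T \<Longrightarrow> g' x t + laplacian E (\<lambda>y. g y t) x \<ge> 0"
    and x: "x \<in> V" and t: "0 \<le> t" "t \<le> T"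
  shows "g x t \<ge> 0"
proof (rule ccontr)
  assume neg: "\<not> g x t \<ge> 0"
  then have xD: "x \<in> D" using outside x t by force
  have t0: "t > 0" using neg init[OF xD] t by (cases "t = 0") auto
  \<comment> \<open>The tilt makes the differential inequality strict.\<close>
  define e where "e = - g x t / (2 * t)"
  have e: "e > 0" using neg t0 by (simp add: e_def divide_neg_pos)
  define k where "k = (\<lambda>x s. g x s + e * s)"
  \<comment> \<open>The slope \<open>e\<close> lifts the value at \<open>(x, t)\<close> by only half
    of its depth, so the tilted function stays negative there.\<close>
  have "k x t = g x t / 2" using t0 by (simp add: k_def e_def)
  then have kneg: "k x t < 0" using neg by simp
  \<comment> \<open>The space-time minimum is taken in two stages: over the compact time interval at
    each vertex, then over the finite set \<open>D\<close>.\<close>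
  have "\<exists>s\<in>{0..t}. \<forall>r\<in>{0..t}. k z s \<le> k z r" if "z \<in> D" for z
  proof (rule continuous_attains_inf)
    show "continuous_on {0..t} (k z)"
      unfolding k_def using t continuous_on_subset[OF cont[OF that], of "{0..t}"]
      by (intro continuous_intros) auto
  qed (use t in auto)
  then obtain m where m: "\<And>z. z \<in> D \<Longrightarrow> m z \<in> {0..t}"
    "\<And>z r. z \<in> D \<Longrightarrow> r \<in> {0..t} \<Longrightarrow> k z (m z) \<le> k z r"
    by metis
  obtain z where z: "z \<in> D" "\<And>y. y \<in> D \<Longrightarrow> k z (m z) \<le> k y (m y)"
    using ex_is_arg_min_if_finite[OF D(1), of "\<lambda>y. k y (m y)"] xD
    by (auto simp: is_arg_min_linorder)
  define s where "s = m z"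
  have min_D: "k z s \<le> k y r" if "y \<in> D" "r \<in> {0..t}" for y r
    using z(2)[OF that(1)] m(2)[OF that] by (simp add: s_def)
  have kzs: "k z s < 0" using min_D[OF xD, of t] kneg t by simp
  have "s \<in> {0..t}" using m(1) z(1) by (simp add: s_def)
  moreover have "s \<noteq> 0" using kzs init[OF z(1)] by (auto simp: k_def)
  ultimately have s: "0 < s" "s \<le> t" by auto
  have der: "(k z has_real_derivative g' z s + e) (at s)"
    unfolding k_def using s t deriv[OF z(1), of s] by (auto intro!: derivative_eq_intros)
  \<comment> \<open>The minimum may sit at the final time \<open>t\<close>, so only earlier times
    are compared, and only a sign of the derivative results.\<close>
  have "g' z s + e \<le> 0"
  proof (rule ccontr)
    assume "\<not> g' z s + e \<le> 0"
    then obtain d where d: "d > 0" "\<And>h. h > 0 \<Longrightarrow> h < d \<Longrightarrow> k z (s - h) < k z s"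
      using DERIV_pos_inc_left[OF der] by auto
    define h where "h = min (d / 2) s"
    have "h > 0" "h < d" "h \<le> s" using d(1) s by (auto simp: h_def)
    then have "k z (s - h) < k z s" "s - h \<in> {0..t}" using d(2)[of h] s by auto
    then show False using min_D[OF z(1), of "s - h"] by linarith
  qed
  moreover have "laplacian E (\<lambda>y. g y s) z \<le> 0"
  proof (rule laplacian_nonpos_at_min)
    fix y assume y: "y \<in> V"
    show "g z s \<le> g y s"
    \<comment> \<open>Within \<open>D\<close> both tilts equal \<open>e * s\<close> and cancel.
      Outside \<open>D\<close> the minimum says nothing, but there \<open>g\<close> is non-negative
      while \<open>g z s\<close> is negative.\<close>
    proof (cases "y \<in> D")
      case True
      then show ?thesis using min_D[OF True, of s] s by (simp add: k_def)
    next
      case False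
      have "0 \<le> e * s" using e s by simp
      then have "g z s < 0" using kzs by (simp add: k_def)
      also have "0 \<le> g y s" using outside[of y s] False y s t by auto
      finally show ?thesis by simp
    qed
  qed
  ultimately show False using super[OF z(1), of s] s t e by linarith
qed

text \<open>The equation is imposed at the vertices of \<open>D\<close> only, yet the Laplacian also
  reads the neighbours outside; the values there act as boundary data.\<close>

definition solves_heat_on :: "'a set \<Rightarrow> (real \<Rightarrow> 'a \<Rightarrow> real) \<Rightarrow> bool" where
  "solves_heat_on D u \<longleftrightarrow> (\<forall>x\<in>D. \<forall>t\<ge>0.
     ((\<lambda>s. u s x) has_real_derivative - laplacian E (u t) x) (at t within {0..}))"

lemma solves_heat_onD:
  "solves_heat_on D u \<Longrightarrow> x \<in> D \<Longrightarrow> t \<ge> 0 \<Longrightarrow>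
     ((\<lambda>s. u s x) has_real_derivative - laplacian E (u t) x) (at t within {0..})"
  by (simp add: solves_heat_on_def)

lemma solves_heat_on_deriv_at:
  assumes "solves_heat_on D u" "x \<in> D" "t > 0"
  shows "((\<lambda>s. u s x) has_real_derivative - laplacian E (u t) x) (at t)"
proof -
  have "at t within {0..} = at t" using assms(3) by (intro at_within_interior) (auto simp: interior_Ici)
  then show ?thesis using solves_heat_onD[OF assms(1,2), of t] assms(3) by simp
qed

lemma solves_heat_on_continuous:
  assumes "solves_heat_on D u" "x \<in> D"
  shows "continuous_on {0..} (\<lambda>s. u s x)"
  using solves_heat_onD[OF assms] DERIV_continuous by (force simp: continuous_on_eq_continuous_within)

lemma solves_heat_on_mono:
  "solves_heat_on D u \<Longrightarrow> D' \<subseteq> D \<Longrightarrow> solves_heat_on D' u"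
  by (auto simp: solves_heat_on_def)

text \<open>The minimum principle for \<open>w - u\<close>. The upper function is asked to solve the
  equation at positive times and to be continuous at 0, because that is all a
  \<open>heat_solution\<close> provides.\<close>

lemma comparison:
  assumes D: "finite D" "D \<subseteq> V"
    and u: "solves_heat_on D u"
    and cont: "\<And>x. x \<in> D \<Longrightarrow> continuous_on {0..} (\<lambda>t. w t x)"
    and deriv: "\<And>x t. x \<in> D \<Longrightarrow> t > 0 \<Longrightarrow>
      ((\<lambda>s. w s x) has_real_derivative - laplacian E (w t) x) (at t)"
    and init: "\<And>x. x \<in> D \<Longrightarrow> u 0 x \<le> w 0 x"
    and outside: "\<And>x t. x \<in> V - D \<Longrightarrow> t \<ge> 0 \<Longrightarrow> u t x \<le> w t x"
    and x: "x \<in> V" and t: "t \<ge> 0"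
  shows "u t x \<le> w t x"
proof -
  have "w t x - u t x \<ge> 0"
  proof (rule parabolic_minimum_principle[OF D, where T = t and g = "\<lambda>x t. w t x - u t x"
        and g' = "\<lambda>x t. - laplacian E (w t) x - - laplacian E (u t) x"])
    fix x assume "x \<in> D"
    then show "continuous_on {0..t} (\<lambda>t. w t x - u t x)"
      using cont solves_heat_on_continuous[OF u]
      by (intro continuous_on_diff; intro continuous_on_subset[where t = "{0..t}" and s = "{0..}"]) auto
  next
    fix x s :: _ assume "x \<in> D" "(0::real) < s"
    then show "((\<lambda>t. w t x - u t x) has_real_derivative - laplacian E (w s) x - - laplacian E (u s) x) (at s)"
      using deriv solves_heat_on_deriv_at[OF u] by (intro DERIV_diff) auto
  qed (use init outside x t in \<open>auto simp: laplacian_diff\<close>)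
  then show ?thesis by simp
qed

section \<open>The Dirichlet heat kernel of a finite set as a matrix exponential\<close>

definition dirichlet_op :: "'a set \<Rightarrow> ('a \<Rightarrow> real) \<Rightarrow> 'a \<Rightarrow> real" where
  "dirichlet_op D f x = (if x \<in> D then - laplacian E f x else 0)"

text \<open>On functions vanishing outside \<open>D\<close>, \<open>dirichlet_op\<close> is a finite
  matrix, the generator of the heat flow killed outside \<open>D\<close>. This is column
  \<open>y\<close> of its n-th power, and the zero column if \<open>y\<close> lies outside
  \<open>D\<close>.\<close>

definition dirichlet_coeff :: "'a set \<Rightarrow> nat \<Rightarrow> 'a \<Rightarrow> 'a \<Rightarrow> real" where
  "dirichlet_coeff D n y = (dirichlet_op D ^^ n) (\<lambda>z. if z = y \<and> y \<in> D then 1 else 0)"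

definition dirichlet_kernel :: "'a set \<Rightarrow> real \<Rightarrow> 'a \<Rightarrow> 'a \<Rightarrow> real" where
  "dirichlet_kernel D t x y = (\<Sum>n. dirichlet_coeff D n y x / fact n * t ^ n)"

lemma dirichlet_coeff_Suc: "dirichlet_coeff D (Suc n) y = dirichlet_op D (dirichlet_coeff D n y)"
  by (simp add: dirichlet_coeff_def)

lemma dirichlet_coeff_outside: "x \<notin> D \<Longrightarrow> dirichlet_coeff D n y x = 0"
  by (cases n) (auto simp: dirichlet_coeff_def dirichlet_op_def)

text \<open>One application of the operator multiplies the supremum by at most twice the largest
  degree in \<open>D\<close>; \<open>K\<close> replaces that maximum by the sum of the degrees. The
  kernel series is thereby dominated by an exponential series.\<close>

lemma dirichlet_coeff_bound:
  assumes "finite D" "D \<subseteq> V"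
  obtains K where "K \<ge> 0" "\<And>n x y. \<bar>dirichlet_coeff D n y x\<bar> \<le> K ^ n"
proof
  define K :: real where "K = 2 * (\<Sum>x\<in>D. card {y. adj E x y})"
  show K: "K \<ge> 0" by (simp add: K_def sum_nonneg)
  fix n x y
  show "\<bar>dirichlet_coeff D n y x\<bar> \<le> K ^ n"
  proof (induction n arbitrary: x)
    case 0
    show ?case by (simp add: dirichlet_coeff_def)
  next
    case (Suc n)
    show ?case
    proof (cases "x \<in> D")
      case True
      have "card {y. adj E x y} \<le> (\<Sum>x\<in>D. card {y. adj E x y})"
        using True assms by (intro member_le_sum) auto
      then have "2 * real (card {y. adj E x y}) \<le> K"
        unfolding K_def by (simp add: of_nat_mono flip: of_nat_sum)
      then have "2 * real (card {y. adj E x y}) * K ^ n \<le> K * K ^ n"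
        using K by (intro mult_right_mono) auto
      moreover have "\<bar>laplacian E (dirichlet_coeff D n y) x\<bar> \<le> 2 * real (card {y. adj E x y}) * K ^ n"
        using True assms Suc by (intro laplacian_abs_le) auto
      ultimately show ?thesis using True by (simp add: dirichlet_coeff_Suc dirichlet_op_def)
    next
      case False
      then show ?thesis using K by (simp add: dirichlet_coeff_outside)
    qed
  qed
qed

lemma dirichlet_kernel_summable:
  assumes "finite D" "D \<subseteq> V"
  shows "summable (\<lambda>n. dirichlet_coeff D n y x / fact n * t ^ n)"
proof -
  obtain K where K: "K \<ge> 0" "\<And>n x y. \<bar>dirichlet_coeff D n y x\<bar> \<le> K ^ n"
    using dirichlet_coeff_bound[OF assms] by metis
  show ?thesis
  proof (rule summable_comparison_test')
    show "summable (\<lambda>n. inverse (fact n) * (K * \<bar>t\<bar>) ^ n)" by (rule summable_exp)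
    show "norm (dirichlet_coeff D n y x / fact n * t ^ n) \<le> inverse (fact n) * (K * \<bar>t\<bar>) ^ n" for n
      using mult_right_mono[OF K(2), of "\<bar>t\<bar> ^ n / fact n" n y x]
      by (simp add: abs_mult power_abs field_simps)
  qed
qed

text \<open>The series is differentiated term by term. \<open>diffs\<close> shifts the index, and
  its factor cancels against the factorial, which leaves one further application of the operator;
  the finite neighbour sum commutes with the series.\<close>

lemma dirichlet_kernel_heat:
  assumes D: "finite D" "D \<subseteq> V"
  shows "solves_heat_on D (\<lambda>t x. dirichlet_kernel D t x y)"
  unfolding solves_heat_on_def
proof (intro ballI allI impI)
  fix x t assume x: "x \<in> D"
  have nb: "finite {y. adj E x y}" using x D finite_nbrs by auto
  note summ = dirichlet_kernel_summable[OF D]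
  have dif: "diffs (\<lambda>n. dirichlet_coeff D n y x / fact n) n * t ^ n
      = - (\<Sum>z | adj E x z. dirichlet_coeff D n y x / fact n * t ^ n - dirichlet_coeff D n y z / fact n * t ^ n)" for n
  proof -
    have "diffs (\<lambda>n. dirichlet_coeff D n y x / fact n) n = dirichlet_coeff D (Suc n) y x / fact n"
      by (simp add: diffs_def field_simps del: of_nat_Suc)
    also have "\<dots> = - (\<Sum>z | adj E x z. dirichlet_coeff D n y x - dirichlet_coeff D n y z) / fact n"
      using x by (simp add: dirichlet_coeff_Suc dirichlet_op_def laplacian_def)
    finally show ?thesis
      by (simp add: sum_distrib_left sum_divide_distrib algebra_simps diff_divide_distrib)
  qed
  have "((\<lambda>t. dirichlet_kernel D t x y) has_real_derivative
      (\<Sum>n. diffs (\<lambda>n. dirichlet_coeff D n y x / fact n) n * t ^ n)) (at t)"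
    unfolding dirichlet_kernel_def by (intro termdiffs_strong_converges_everywhere summ)
  also have "(\<Sum>n. diffs (\<lambda>n. dirichlet_coeff D n y x / fact n) n * t ^ n)
      = - laplacian E (\<lambda>z. dirichlet_kernel D t z y) x"
    unfolding dif laplacian_def dirichlet_kernel_def
    by (rule sums_unique[symmetric]) (intro sums_minus sums_sum sums_diff summable_sums summ)
  finally show "((\<lambda>s. dirichlet_kernel D s x y) has_real_derivative
      - laplacian E (\<lambda>z. dirichlet_kernel D t z y) x) (at t within {0..})"
    by (rule has_field_derivative_at_within)
qed

lemma dirichlet_kernel_0:
  "dirichlet_kernel D 0 x y = (if x = y \<and> y \<in> D then 1 else 0)"
  unfolding dirichlet_kernel_def by (subst powser_zero) (auto simp: dirichlet_coeff_def)

lemma dirichlet_kernel_outside: "x \<notin> D \<Longrightarrow> dirichlet_kernel D t x y = 0"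
  by (simp add: dirichlet_kernel_def dirichlet_coeff_outside)

text \<open>On such functions the operator is the adjacency matrix of \<open>D\<close> minus a
  diagonal of degrees, and adjacency is symmetric.\<close>

lemma dirichlet_op_selfadjoint:
  assumes D: "finite D" "D \<subseteq> V"
    and f: "\<And>x. x \<notin> D \<Longrightarrow> f x = 0" and g: "\<And>x. x \<notin> D \<Longrightarrow> g x = 0"
  shows "(\<Sum>x\<in>D. dirichlet_op D f x * g x) = (\<Sum>x\<in>D. f x * dirichlet_op D g x)"
proof -
  \<comment> \<open>The degree counts all neighbours in the graph, while those outside
    \<open>D\<close> contribute nothing to the sum of \<open>h\<close>.\<close>
  have op: "dirichlet_op D h x = (\<Sum>y\<in>D. if adj E x y then h y else 0) - real (card {y. adj E x y}) * h x"
    if "x \<in> D" "\<And>x. x \<notin> D \<Longrightarrow> h x = 0" for h x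
  proof -
    have "(\<Sum>y | adj E x y. h y) = (\<Sum>y\<in>D. if adj E x y then h y else 0)"
      using that D finite_nbrs
      by (subst sum.inter_filter[symmetric]) (auto intro!: sum.mono_neutral_cong_right)
    then show ?thesis using that by (simp add: dirichlet_op_def laplacian_def sum_subtractf)
  qed
  have "(\<Sum>x\<in>D. (\<Sum>y\<in>D. if adj E x y then f y else 0) * g x)
      = (\<Sum>x\<in>D. \<Sum>y\<in>D. if adj E x y then f y * g x else 0)"
    by (simp add: sum_distrib_right if_distrib[of "\<lambda>a. a * _"] cong: if_cong)
  also have "\<dots> = (\<Sum>y\<in>D. \<Sum>x\<in>D. if adj E y x then f y * g x else 0)"
    by (subst sum.swap) (simp add: adj_sym)
  also have "\<dots> = (\<Sum>x\<in>D. f x * (\<Sum>y\<in>D. if adj E x y then g y else 0))"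
    by (simp add: sum_distrib_left if_distrib[of "\<lambda>a. _ * a"] cong: if_cong)
  finally have *: "(\<Sum>x\<in>D. (\<Sum>y\<in>D. if adj E x y then f y else 0) * g x)
      = (\<Sum>x\<in>D. f x * (\<Sum>y\<in>D. if adj E x y then g y else 0))" .
  show ?thesis
    using * by (simp add: op f g left_diff_distrib right_diff_distrib sum_subtractf mult_ac)
qed

lemma dirichlet_op_pow_selfadjoint:
  assumes D: "finite D" "D \<subseteq> V"
    and f: "\<And>x. x \<notin> D \<Longrightarrow> f x = 0" and g: "\<And>x. x \<notin> D \<Longrightarrow> g x = 0"
  shows "(\<Sum>x\<in>D. (dirichlet_op D ^^ n) f x * g x) = (\<Sum>x\<in>D. f x * (dirichlet_op D ^^ n) g x)"
  using g
proof (induction n arbitrary: g)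
  case (Suc n)
  have "(dirichlet_op D ^^ n) f x = 0" if "x \<notin> D" for x
    using that f by (cases n) (auto simp: dirichlet_op_def)
  then have "(\<Sum>x\<in>D. (dirichlet_op D ^^ Suc n) f x * g x) = (\<Sum>x\<in>D. (dirichlet_op D ^^ n) f x * dirichlet_op D g x)"
    using Suc.prems by (simp add: dirichlet_op_selfadjoint[OF D])
  also have "\<dots> = (\<Sum>x\<in>D. f x * (dirichlet_op D ^^ n) (dirichlet_op D g) x)"
    by (rule Suc.IH) (simp add: dirichlet_op_def)
  finally show ?case by (simp add: funpow_swap1)
qed simp

text \<open>Pairing a self-adjoint matrix power with two unit vectors reads off both entries. In the
  limit, symmetry provides the heat equation in the second space variable.\<close>

lemma dirichlet_kernel_sym:
  assumes D: "finite D" "D \<subseteq> V"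
  shows "dirichlet_kernel D t x y = dirichlet_kernel D t y x"
proof -
  have "dirichlet_coeff D n y x = dirichlet_coeff D n x y" for n
  proof (cases "x \<in> D \<and> y \<in> D")
    case True
    define d :: "'a \<Rightarrow> 'a \<Rightarrow> real" where "d = (\<lambda>a z. if z = a then 1 else 0)"
    have "(\<Sum>z\<in>D. (dirichlet_op D ^^ n) (d y) z * d x z) = (\<Sum>z\<in>D. d y z * (dirichlet_op D ^^ n) (d x) z)"
      using True by (intro dirichlet_op_pow_selfadjoint D) (auto simp: d_def)
    then show ?thesis using True D unfolding dirichlet_coeff_def d_def by (simp add: if_distrib[of "\<lambda>a. a * _"] if_distrib[of "\<lambda>a. _ * a"] cong: if_cong)
  next
    case False
    have "dirichlet_coeff D n b a = 0" if "b \<notin> D" for a b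
    proof -
      have "dirichlet_coeff D n b = (\<lambda>z. 0)"
        by (induction n) (auto simp: dirichlet_coeff_def dirichlet_op_def fun_eq_iff[symmetric] that laplacian_const)
      then show ?thesis by simp
    qed
    then show ?thesis using False dirichlet_coeff_outside by metis
  qed
  then show ?thesis by (simp add: dirichlet_kernel_def)
qed

section \<open>Bounds and monotonicity of Dirichlet kernels and their masses\<close>

lemma solves_heat_on_const: "solves_heat_on D (\<lambda>t x. c)"
  by (simp add: solves_heat_on_def laplacian_const)

lemma solves_heat_on_sum:
  assumes "\<And>i. i \<in> I \<Longrightarrow> solves_heat_on D (u i)"
  shows "solves_heat_on D (\<lambda>t x. \<Sum>i\<in>I. u i t x)"
  unfolding solves_heat_on_def laplacian_sum sum_negf[symmetric]
  using assms by (auto intro!: DERIV_sum solves_heat_onD)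

lemma solves_heat_on_one_minus:
  assumes "solves_heat_on D u"
  shows "solves_heat_on D (\<lambda>t x. 1 - u t x)"
  unfolding solves_heat_on_def laplacian_diff laplacian_const
  using assms by (auto intro!: derivative_eq_intros solves_heat_onD)

text \<open>The equation is autonomous. Comparing a solution with its own time shift does the work
  of a semigroup law below.\<close>

lemma solves_heat_on_shift:
  assumes "solves_heat_on D u" "s \<ge> 0"
  shows "solves_heat_on D (\<lambda>t. u (s + t))"
  unfolding solves_heat_on_def
proof (intro ballI allI impI)
  fix x and t :: real assume x: "x \<in> D" and t: "t \<ge> 0"
  have "((\<lambda>r. u r x) has_real_derivative - laplacian E (u (s + t)) x) (at (s + t) within (+) s ` {0..})"
    using solves_heat_onD[OF assms(1) x, of "s + t"] t assms(2)
    by (auto intro: has_field_derivative_subset)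
  from DERIV_image_chain[OF this, of 1]
  have "((+) s has_real_derivative 1) (at t within {0..}) \<Longrightarrow>
      ((\<lambda>r. u (s + r) x) has_real_derivative - laplacian E (u (s + t)) x) (at t within {0..})"
    by (simp add: o_def)
  moreover have "((+) s has_real_derivative 1) (at t within {0..})"
    by (auto intro!: derivative_eq_intros)
  ultimately show "((\<lambda>r. u (s + r) x) has_real_derivative - laplacian E (u (s + t)) x) (at t within {0..})"
    by simp
qed

lemma comparison_heat:
  assumes D: "finite D" "D \<subseteq> V"
    and u: "solves_heat_on D u" and w: "solves_heat_on D w"
    and init: "\<And>x. x \<in> D \<Longrightarrow> u 0 x \<le> w 0 x"
    and outside: "\<And>x t. x \<in> V - D \<Longrightarrow> t \<ge> 0 \<Longrightarrow> u t x \<le> w t x"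
    and x: "x \<in> V" and t: "t \<ge> 0"
  shows "u t x \<le> w t x"
  using comparison[OF D u solves_heat_on_continuous[OF w] solves_heat_on_deriv_at[OF w] init outside x t]
  by blast

definition dirichlet_mass :: "'a set \<Rightarrow> real \<Rightarrow> 'a \<Rightarrow> real" where
  "dirichlet_mass D t x = (\<Sum>y\<in>D. dirichlet_kernel D t x y)"

lemma dirichlet_mass_heat:
  assumes "finite D" "D \<subseteq> V"
  shows "solves_heat_on D (dirichlet_mass D)"
proof -
  have "solves_heat_on D (\<lambda>t x. \<Sum>y\<in>D. dirichlet_kernel D t x y)"
    by (intro solves_heat_on_sum dirichlet_kernel_heat assms)
  then show ?thesis by (simp add: dirichlet_mass_def[abs_def])
qed

lemma dirichlet_mass_0:
  assumes "finite D" "x \<in> D"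
  shows "dirichlet_mass D 0 x = 1"
  using assms by (simp add: dirichlet_mass_def dirichlet_kernel_0)

lemma dirichlet_mass_outside: "x \<notin> D \<Longrightarrow> dirichlet_mass D t x = 0"
  by (simp add: dirichlet_mass_def dirichlet_kernel_outside)

lemma dirichlet_kernel_nonneg:
  assumes D: "finite D" "D \<subseteq> V" and t: "t \<ge> 0"
  shows "dirichlet_kernel D t x y \<ge> 0"
proof (cases "x \<in> D")
  case True
  show ?thesis
    by (rule comparison_heat[OF D solves_heat_on_const dirichlet_kernel_heat[OF D]])
      (use True D t in \<open>auto simp: dirichlet_kernel_0 dirichlet_kernel_outside\<close>)
qed (simp add: dirichlet_kernel_outside)

lemma dirichlet_kernel_le_1:
  assumes D: "finite D" "D \<subseteq> V" and t: "t \<ge> 0" and x: "x \<in> V"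
  shows "dirichlet_kernel D t x y \<le> 1"
  by (rule comparison_heat[OF D dirichlet_kernel_heat[OF D] solves_heat_on_const])
    (use x t in \<open>auto simp: dirichlet_kernel_0 dirichlet_kernel_outside\<close>)

text \<open>Outside the smaller set its kernel vanishes and the larger one is non-negative; inside,
  both solve the equation with the same initial values. This makes the kernels of the balls
  increase.\<close>

lemma dirichlet_kernel_mono:
  assumes D: "finite D" "D \<subseteq> V" and D': "finite D'" "D' \<subseteq> V" and sub: "D \<subseteq> D'"
    and t: "t \<ge> 0" and x: "x \<in> V"
  shows "dirichlet_kernel D t x y \<le> dirichlet_kernel D' t x y"
  by (rule comparison_heat[OF D dirichlet_kernel_heat[OF D]
        solves_heat_on_mono[OF dirichlet_kernel_heat[OF D'] sub]])
    (use x t sub in \<open>auto simp: dirichlet_kernel_0 dirichlet_kernel_outside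
      intro: dirichlet_kernel_nonneg[OF D']\<close>)

lemma dirichlet_mass_nonneg:
  assumes "finite D" "D \<subseteq> V" "t \<ge> 0"
  shows "dirichlet_mass D t x \<ge> 0"
  unfolding dirichlet_mass_def by (intro sum_nonneg dirichlet_kernel_nonneg assms)

lemma dirichlet_mass_le_1:
  assumes D: "finite D" "D \<subseteq> V" and t: "t \<ge> 0" and x: "x \<in> V"
  shows "dirichlet_mass D t x \<le> 1"
  by (rule comparison_heat[OF D dirichlet_mass_heat[OF D] solves_heat_on_const])
    (use x t D in \<open>auto simp: dirichlet_mass_0 dirichlet_mass_outside\<close>)

lemma dirichlet_mass_mono:
  assumes D: "finite D" "D \<subseteq> V" and D': "finite D'" "D' \<subseteq> V" and sub: "D \<subseteq> D'"
    and t: "t \<ge> 0" and x: "x \<in> V"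
  shows "dirichlet_mass D t x \<le> dirichlet_mass D' t x"
  unfolding dirichlet_mass_def
  by (rule order_trans[OF sum_mono sum_mono2])
    (use assms in \<open>auto intro: dirichlet_kernel_mono dirichlet_kernel_nonneg\<close>)

text \<open>The shifted mass starts from values at most 1, the unshifted one from exactly 1 on
  \<open>D\<close>.\<close>

lemma dirichlet_mass_antimono_time:
  assumes D: "finite D" "D \<subseteq> V" and t: "t \<ge> 0" and s: "s \<ge> 0" and x: "x \<in> V"
  shows "dirichlet_mass D (s + t) x \<le> dirichlet_mass D t x"
  by (rule comparison_heat[OF D solves_heat_on_shift[OF dirichlet_mass_heat[OF D] s]
        dirichlet_mass_heat[OF D]])
    (use x s t D in \<open>auto simp: dirichlet_mass_0 dirichlet_mass_outside intro: dirichlet_mass_le_1\<close>)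

section \<open>Limits of heat solutions along the balls\<close>

lemma solves_heat_on_limit:
  assumes u: "\<And>n. solves_heat_on (ball_set n) (u n)"
    and bound: "\<And>n t x. t \<ge> 0 \<Longrightarrow> x \<in> V \<Longrightarrow> \<bar>u n t x\<bar> \<le> 1"
    and lim: "\<And>t x. t \<ge> 0 \<Longrightarrow> x \<in> V \<Longrightarrow> (\<lambda>n. u n t x) \<longlonglongrightarrow> f t x"
  shows "solves_heat_on V f"
proof -
  \<comment> \<open>Pointwise convergence does not control derivatives, so the equation is first
    passed to the limit in integral form, by dominated convergence.\<close>
  have int: "((\<lambda>s. - laplacian E (f s) x) has_integral f r x - f 0 x) {0..r}"
    if x: "x \<in> V" and r: "r \<ge> 0" for x r
  proof -
    obtain N where N: "\<And>n. n \<ge> N \<Longrightarrow> x \<in> ball_set n"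
      using ball_set_exhausts[OF x] by (auto simp: eventually_sequentially)
    \<comment> \<open>The index is shifted by \<open>N\<close> so that every member of the sequence
      satisfies the equation at \<open>x\<close>.\<close>
    define g where "g = (\<lambda>n s. - laplacian E (u (n + N) s) x)"
    have g_int: "(g n has_integral u (n + N) r x - u (n + N) 0 x) {0..r}" for n
      unfolding g_def
    proof (rule fundamental_theorem_of_calculus[OF r])
      fix s assume s: "s \<in> {0..r}"
      then have "((\<lambda>s. u (n + N) s x) has_real_derivative - laplacian E (u (n + N) s) x) (at s within {0..})"
        using N by (intro solves_heat_onD[OF u]) auto
      then show "((\<lambda>s. u (n + N) s x) has_vector_derivative - laplacian E (u (n + N) s) x) (at s within {0..r})"
        unfolding has_real_derivative_iff_has_vector_derivative
        by (rule has_vector_derivative_within_subset) auto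
    qed
    have g_bound: "norm (g n s) \<le> 2 * real (card {y. adj E x y}) * 1" if "s \<in> {0..r}" for n s
      using that x bound laplacian_abs_le[of x "u (n + N) s" 1] by (simp add: g_def)
    have g_lim: "(\<lambda>n. g n s) \<longlonglongrightarrow> - laplacian E (f s) x" if "s \<in> {0..r}" for s
      unfolding g_def using that x lim
      by (intro tendsto_minus laplacian_tendsto LIMSEQ_ignore_initial_segment) auto
    have g_intble: "g n integrable_on {0..r}" for n
      using g_int by blast
    note dc = dominated_convergence[OF g_intble integrable_const_ivl g_bound g_lim]
    have "(\<lambda>n. integral {0..r} (g n)) = (\<lambda>n. u (n + N) r x - u (n + N) 0 x)"
      using integral_unique[OF g_int] by auto
    moreover have "(\<lambda>n. u (n + N) r x - u (n + N) 0 x) \<longlonglongrightarrow> f r x - f 0 x"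
      using x r lim by (intro tendsto_diff LIMSEQ_ignore_initial_segment) auto
    ultimately have "integral {0..r} (\<lambda>s. - laplacian E (f s) x) = f r x - f 0 x"
      using dc(2) LIMSEQ_unique by metis
    then show ?thesis using dc(1) by (metis integrable_integral)
  qed
  have f_eq: "f r x = f 0 x + integral {0..r} (\<lambda>s. - laplacian E (f s) x)" if "x \<in> V" "r \<ge> 0" for x r
    using integral_unique[OF int[OF that]] by simp
  \<comment> \<open>The integral form makes the limit continuous in time at every vertex. Hence the
    integrand is continuous too, and the fundamental theorem returns the differential
    equation.\<close>
  have cont: "continuous_on {0..T} (\<lambda>r. f r x)" if "x \<in> V" "T \<ge> 0" for x T
  proof -
    have "continuous_on {0..T} (\<lambda>r. f 0 x + integral {0..r} (\<lambda>s. - laplacian E (f s) x))"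
      using int[OF that] by (intro continuous_on_add continuous_on_const indefinite_integral_continuous_1) blast
    then show ?thesis
      by (rule continuous_on_eq) (rule f_eq[OF that(1), symmetric], simp)
  qed
  show ?thesis
    unfolding solves_heat_on_def
  proof (intro ballI allI impI)
    fix x and t :: real assume x: "x \<in> V" and t: "t \<ge> 0"
    have "continuous_on {0..t + 1} (\<lambda>s. - laplacian E (f s) x)"
      using x t cont by (intro continuous_on_minus laplacian_continuous) auto
    then have "((\<lambda>r. integral {0..r} (\<lambda>s. - laplacian E (f s) x)) has_real_derivative - laplacian E (f t) x)
        (at t within {0..t + 1})"
      using t by (intro integral_has_real_derivative) auto
    then have "((\<lambda>r. f 0 x + integral {0..r} (\<lambda>s. - laplacian E (f s) x)) has_real_derivative - laplacian E (f t) x)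
        (at t within {0..t + 1})"
      using DERIV_add[OF DERIV_const] by force
    then have "((\<lambda>r. f r x) has_real_derivative - laplacian E (f t) x) (at t within {0..t + 1})"
      by (rule has_field_derivative_transform_within[where d = 1]) (use t f_eq[OF x, symmetric] in auto)
    moreover have "at t within {0..t + 1} = at t within {0..}"
      by (rule at_within_nhd[of t "{..<t + 1}"]) auto
    ultimately show "((\<lambda>r. f r x) has_real_derivative - laplacian E (f t) x) (at t within {0..})" by simp
  qed
qed

text \<open>Each time derivative is a further application of minus the Laplacian, a finite sum of
  solutions, so the n-th derivative is the n-th iterate.\<close>

lemma solves_heat_smooth:
  assumes u: "solves_heat_on V u" and x: "x \<in> V"
  shows "smooth_on_nonneg (\<lambda>t. u t x)"
  unfolding smooth_on_nonneg_def
proof (intro exI[of _ "\<lambda>n t. ((\<lambda>f z. - laplacian E f z) ^^ n) (u t) x"] conjI allI impI)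
  fix n and t :: real assume t: "t \<ge> 0"
  show "((\<lambda>t. ((\<lambda>f z. - laplacian E f z) ^^ n) (u t) x) has_real_derivative
      ((\<lambda>f z. - laplacian E f z) ^^ Suc n) (u t) x) (at t within {0..})"
    using x
  proof (induction n arbitrary: x)
    case 0
    then show ?case using solves_heat_onD[OF u _ t] by simp
  next
    case (Suc n)
    have "((\<lambda>t. - laplacian E (((\<lambda>f z. - laplacian E f z) ^^ n) (u t)) x) has_real_derivative
      - laplacian E (((\<lambda>f z. - laplacian E f z) ^^ Suc n) (u t)) x) (at t within {0..})"
      by (intro DERIV_minus laplacian_deriv Suc)
    then show ?case by simp
  qed
qed simp

section \<open>Identification of the limit with the heat kernel and of its total mass\<close>

definition limit_kernel :: "real \<Rightarrow> 'a \<Rightarrow> 'a \<Rightarrow> real" where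
  "limit_kernel t x y = lim (\<lambda>n. dirichlet_kernel (ball_set n) t x y)"

definition limit_mass :: "real \<Rightarrow> 'a \<Rightarrow> real" where
  "limit_mass t x = lim (\<lambda>n. dirichlet_mass (ball_set n) t x)"

lemma incseq_bounded_lim:
  fixes X :: "nat \<Rightarrow> real"
  assumes "\<And>m n. m \<le> n \<Longrightarrow> X m \<le> X n" "\<And>n. X n \<le> B"
  shows "X \<longlonglongrightarrow> lim X"
proof -
  obtain L where "X \<longlonglongrightarrow> L"
    using assms incseq_convergent[of X B] unfolding incseq_def by blast
  then show ?thesis by (simp add: limI)
qed

lemma limit_kernel_tendsto:
  assumes "t \<ge> 0" "x \<in> V"
  shows "(\<lambda>n. dirichlet_kernel (ball_set n) t x y) \<longlonglongrightarrow> limit_kernel t x y"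
  unfolding limit_kernel_def using assms
  by (intro incseq_bounded_lim[where B = 1] dirichlet_kernel_mono dirichlet_kernel_le_1
      ball_set_finite ball_set_subset ball_set_mono) auto

lemma limit_mass_tendsto:
  assumes "t \<ge> 0" "x \<in> V"
  shows "(\<lambda>n. dirichlet_mass (ball_set n) t x) \<longlonglongrightarrow> limit_mass t x"
  unfolding limit_mass_def using assms
  by (intro incseq_bounded_lim[where B = 1] dirichlet_mass_mono dirichlet_mass_le_1
      ball_set_finite ball_set_subset ball_set_mono) auto

lemma dirichlet_kernel_le_limit:
  assumes "t \<ge> 0" "x \<in> V"
  shows "dirichlet_kernel (ball_set n) t x y \<le> limit_kernel t x y"
  using assms
  by (intro LIMSEQ_le_const[OF limit_kernel_tendsto] exI[of _ n] allI impI dirichlet_kernel_mono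
      ball_set_finite ball_set_subset ball_set_mono) auto

lemma limit_kernel_heat: "solves_heat_on V (\<lambda>t x. limit_kernel t x y)"
  by (rule solves_heat_on_limit[where u = "\<lambda>n t x. dirichlet_kernel (ball_set n) t x y"])
    (auto intro: dirichlet_kernel_heat limit_kernel_tendsto ball_set_finite ball_set_subset[THEN subsetD]
      simp: abs_of_nonneg dirichlet_kernel_nonneg dirichlet_kernel_le_1 ball_set_finite ball_set_subset)

lemma limit_mass_heat: "solves_heat_on V limit_mass"
  by (rule solves_heat_on_limit[where u = "\<lambda>n. dirichlet_mass (ball_set n)"])
    (auto intro: dirichlet_mass_heat limit_mass_tendsto ball_set_finite ball_set_subset[THEN subsetD]
      simp: abs_of_nonneg dirichlet_mass_nonneg dirichlet_mass_le_1 ball_set_finite ball_set_subset)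

lemma limit_kernel_sym: "limit_kernel t x y = limit_kernel t y x"
  unfolding limit_kernel_def
  by (subst dirichlet_kernel_sym[OF ball_set_finite ball_set_subset]) (rule refl)

lemma limit_kernel_0:
  assumes "x \<in> V"
  shows "limit_kernel 0 x y = (if x = y then 1 else 0)"
proof -
  have "eventually (\<lambda>n. dirichlet_kernel (ball_set n) 0 x y = (if x = y then 1 else 0)) sequentially"
    using ball_set_exhausts[OF assms] by eventually_elim (auto simp: dirichlet_kernel_0)
  then show ?thesis
    by (rule LIMSEQ_unique[OF limit_kernel_tendsto[OF order_refl assms] tendsto_eventually])
qed

lemma limit_kernel_candidate: "heat_kernel_candidate V E limit_kernel"
  unfolding heat_kernel_candidate_def
proof (intro ballI conjI allI impI)
  fix x y assume xy: "x \<in> V" "y \<in> V"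
  show "smooth_on_nonneg (\<lambda>t. limit_kernel t x y)"
    by (rule solves_heat_smooth[OF limit_kernel_heat xy(1)])
  show "limit_kernel 0 x y = (if x = y then 1 else 0)"
    by (rule limit_kernel_0[OF xy(1)])
  fix t :: real assume t: "t \<ge> 0"
  have "limit_kernel t x y \<ge> 0"
    using t xy by (intro LIMSEQ_le_const[OF limit_kernel_tendsto] exI allI impI dirichlet_kernel_nonneg
      ball_set_finite ball_set_subset) auto
  moreover have "limit_kernel t x y \<le> 1"
    using t xy by (intro LIMSEQ_le_const2[OF limit_kernel_tendsto] exI allI impI dirichlet_kernel_le_1
      ball_set_finite ball_set_subset) auto
  ultimately show "limit_kernel t x y \<in> {0..1}" by simp
  show "((\<lambda>s. limit_kernel s x y) has_real_derivative - laplacian E (\<lambda>z. limit_kernel t z y) x)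
      (at t within {0..})"
    by (rule solves_heat_onD[OF limit_kernel_heat xy(1) t])
  show "((\<lambda>s. limit_kernel s x y) has_real_derivative - laplacian E (\<lambda>z. limit_kernel t x z) y)
      (at t within {0..})"
  proof -
    have "(\<lambda>s. limit_kernel s x y) = (\<lambda>s. limit_kernel s y x)"
      "(\<lambda>z. limit_kernel t x z) = (\<lambda>z. limit_kernel t z x)"
      by (intro ext limit_kernel_sym)+
    then show ?thesis
      using solves_heat_onD[OF limit_kernel_heat[of x] xy(2) t] by (simp only:)
  qed
qed

text \<open>Any candidate is non-negative outside a ball and has the same initial values inside, so
  it dominates the Dirichlet kernel of each ball.\<close>

lemma limit_kernel_least:
  assumes q: "heat_kernel_candidate V E q" and t: "t \<ge> 0" and x: "x \<in> V" and y: "y \<in> V"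
  shows "limit_kernel t x y \<le> q t x y"
proof -
  have heat: "solves_heat_on V (\<lambda>t x. q t x y)"
    using q y by (auto simp: heat_kernel_candidate_def solves_heat_on_def)
  have q0: "q 0 z y = (if z = y then 1 else 0)" "s \<ge> 0 \<Longrightarrow> q s z y \<ge> 0" if "z \<in> V" for z s
    using q y that by (auto simp: heat_kernel_candidate_def)
  have "dirichlet_kernel (ball_set n) t x y \<le> q t x y" for n
    by (rule comparison_heat[OF ball_set_finite ball_set_subset dirichlet_kernel_heat[OF ball_set_finite ball_set_subset]
          solves_heat_on_mono[OF heat ball_set_subset]])
      (use x t q0 ball_set_subset[of n] in \<open>auto simp: dirichlet_kernel_0 dirichlet_kernel_outside subset_iff\<close>)
  then show ?thesis by (intro LIMSEQ_le_const2[OF limit_kernel_tendsto[OF t x]]) auto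
qed

text \<open>The limit kernel witnesses that the choice defining \<open>heat_kernel\<close> is a
  genuine minimum, and two minimal candidates bound each other.\<close>

lemma heat_kernel_eq_limit_kernel:
  assumes "t \<ge> 0" "x \<in> V" "y \<in> V"
  shows "heat_kernel V E t x y = limit_kernel t x y"
proof -
  have lim: "is_heat_kernel V E limit_kernel"
    using limit_kernel_candidate limit_kernel_least by (auto simp: is_heat_kernel_def)
  then have "is_heat_kernel V E (heat_kernel V E)"
    unfolding heat_kernel_def by (rule someI[where P = "is_heat_kernel V E"])
  with lim have "heat_kernel V E t x y \<le> limit_kernel t x y" "limit_kernel t x y \<le> heat_kernel V E t x y"
    unfolding is_heat_kernel_def using assms by blast+
  then show ?thesis by (rule antisym)
qed

text \<open>A monotone exchange of the limit along balls with the sum over \<open>V\<close>: finite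
  partial sums of the limit kernel stay below the limit mass, and the mass of each ball stays below
  the infinite sum.\<close>

lemma heat_semigroup_one_eq:
  assumes t: "t \<ge> 0" and x: "x \<in> V"
  shows "heat_semigroup_one V E t x = limit_mass t x"
proof -
  let ?D = ball_set
  note D = ball_set_finite ball_set_subset
  have nonneg: "limit_kernel t x y \<ge> 0" if "y \<in> V" for y
    using limit_kernel_candidate that x t by (auto simp: heat_kernel_candidate_def)
  have partial: "(\<Sum>y\<in>F. limit_kernel t x y) \<le> limit_mass t x" if F: "finite F" "F \<subseteq> V" for F
  proof (rule LIMSEQ_le[OF tendsto_sum limit_mass_tendsto[OF t x]])
    show "(\<lambda>n. dirichlet_kernel (?D n) t x y) \<longlonglongrightarrow> limit_kernel t x y" for y
      by (rule limit_kernel_tendsto[OF t x])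
    \<comment> \<open>By symmetry the kernel also vanishes when its second argument leaves the ball,
      so only \<open>F \<inter> ?D n\<close> counts.\<close>
    have "(\<Sum>y\<in>F. dirichlet_kernel (?D n) t x y) \<le> dirichlet_mass (?D n) t x" for n
    proof -
      have "(\<Sum>y\<in>F. dirichlet_kernel (?D n) t x y) = (\<Sum>y\<in>F \<inter> ?D n. dirichlet_kernel (?D n) t x y)"
        using F dirichlet_kernel_sym[OF D, of n t x] dirichlet_kernel_outside
        by (intro sum.mono_neutral_right) auto
      also have "\<dots> \<le> dirichlet_mass (?D n) t x"
        unfolding dirichlet_mass_def by (intro sum_mono2 D dirichlet_kernel_nonneg t) auto
      finally show ?thesis .
    qed
    then show "\<exists>N. \<forall>n\<ge>N. (\<Sum>y\<in>F. dirichlet_kernel (?D n) t x y) \<le> dirichlet_mass (?D n) t x"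
      by blast
  qed
  have summable: "(\<lambda>y. limit_kernel t x y) summable_on V"
    using nonneg partial
    by (intro nonneg_bdd_above_summable_on) (auto intro!: bdd_aboveI[of _ "limit_mass t x"])
  have "(\<Sum>\<^sub>\<infinity>y\<in>V. limit_kernel t x y) \<le> limit_mass t x"
    by (rule infsum_le_finite_sums[OF summable partial])
  moreover have "limit_mass t x \<le> (\<Sum>\<^sub>\<infinity>y\<in>V. limit_kernel t x y)"
  proof (rule LIMSEQ_le_const2[OF limit_mass_tendsto[OF t x]], intro exI allI impI)
    fix n
    have "dirichlet_mass (?D n) t x \<le> (\<Sum>y\<in>?D n. limit_kernel t x y)"
      unfolding dirichlet_mass_def by (intro sum_mono dirichlet_kernel_le_limit t x)
    also have "\<dots> \<le> (\<Sum>\<^sub>\<infinity>y\<in>V. limit_kernel t x y)"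
      using nonneg by (intro finite_sum_le_infsum summable D) auto
    finally show "dirichlet_mass (?D n) t x \<le> (\<Sum>\<^sub>\<infinity>y\<in>V. limit_kernel t x y)" .
  qed
  moreover have "heat_semigroup_one V E t x = (\<Sum>\<^sub>\<infinity>y\<in>V. limit_kernel t x y)"
    unfolding heat_semigroup_one_def using t x by (intro infsum_cong heat_kernel_eq_limit_kernel)
  ultimately show ?thesis by linarith
qed

section \<open>The mass defect, its maximality and the spreading of its zeros\<close>

definition defect :: "real \<Rightarrow> 'a \<Rightarrow> real" where
  "defect t x = 1 - limit_mass t x"

lemma defect_heat: "solves_heat_on V defect"
  unfolding defect_def[abs_def] by (rule solves_heat_on_one_minus[OF limit_mass_heat])

lemma defect_0:
  assumes "x \<in> V"
  shows "defect 0 x = 0"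
proof -
  have "eventually (\<lambda>n. dirichlet_mass (ball_set n) 0 x = 1) sequentially"
    using ball_set_exhausts[OF assms] by eventually_elim (auto simp: dirichlet_mass_0 ball_set_finite)
  then have "limit_mass 0 x = 1"
    by (rule LIMSEQ_unique[OF limit_mass_tendsto[OF order_refl assms] tendsto_eventually])
  then show ?thesis by (simp add: defect_def)
qed

lemma defect_nonneg:
  assumes "t \<ge> 0" "x \<in> V"
  shows "defect t x \<ge> 0"
proof -
  have "limit_mass t x \<le> 1"
    using assms by (intro LIMSEQ_le_const2[OF limit_mass_tendsto] exI allI impI dirichlet_mass_le_1
      ball_set_finite ball_set_subset) auto
  then show ?thesis by (simp add: defect_def)
qed

lemma defect_le_1:
  assumes "t \<ge> 0" "x \<in> V"
  shows "defect t x \<le> 1"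
proof -
  have "limit_mass t x \<ge> 0"
    using assms by (intro LIMSEQ_le_const[OF limit_mass_tendsto] exI allI impI dirichlet_mass_nonneg
      ball_set_finite ball_set_subset) auto
  then show ?thesis by (simp add: defect_def)
qed

text \<open>On each ball the Dirichlet mass is compared with \<open>1 - w\<close>, which is
  non-negative outside the ball and equals 1 at time 0; then the balls grow.\<close>

lemma defect_greatest:
  assumes cont: "\<And>x. x \<in> V \<Longrightarrow> continuous_on {0..} (\<lambda>t. w t x)"
    and deriv: "\<And>x t. x \<in> V \<Longrightarrow> t > 0 \<Longrightarrow>
      ((\<lambda>s. w s x) has_real_derivative - laplacian E (w t) x) (at t)"
    and init: "\<And>x. x \<in> V \<Longrightarrow> w 0 x = 0"
    and le: "\<And>x t. x \<in> V \<Longrightarrow> t \<ge> 0 \<Longrightarrow> w t x \<le> 1"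
    and x: "x \<in> V" and t: "t \<ge> 0"
  shows "w t x \<le> defect t x"
proof -
  have "dirichlet_mass (ball_set n) t x \<le> 1 - w t x" for n
  proof (rule comparison[OF ball_set_finite ball_set_subset dirichlet_mass_heat[OF ball_set_finite ball_set_subset]
        _ _ _ _ x t, where w = "\<lambda>t x. 1 - w t x"])
    fix z assume "z \<in> ball_set n"
    then have z: "z \<in> V" using ball_set_subset by auto
    show "continuous_on {0..} (\<lambda>t. 1 - w t z)"
      by (intro continuous_on_diff continuous_on_const cont z)
    show "dirichlet_mass (ball_set n) 0 z \<le> 1 - w 0 z"
      using init[OF z] dirichlet_mass_le_1[OF ball_set_finite ball_set_subset _ z] by simp
    show "((\<lambda>s. 1 - w s z) has_real_derivative - laplacian E (\<lambda>x. 1 - w s x) z) (at s)" if "s > 0" for s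
      using deriv[OF z that] by (auto simp: laplacian_diff laplacian_const intro!: derivative_eq_intros)
  qed (use le in \<open>auto simp: dirichlet_mass_outside\<close>)
  then have "limit_mass t x \<le> 1 - w t x"
    by (intro LIMSEQ_le_const2[OF limit_mass_tendsto[OF t x]]) auto
  then show ?thesis by (simp add: defect_def)
qed

lemma defect_mono:
  assumes "0 \<le> s" "s \<le> t" "x \<in> V"
  shows "defect s x \<le> defect t x"
proof -
  have "limit_mass t x \<le> limit_mass s x"
  proof (rule LIMSEQ_le[OF limit_mass_tendsto limit_mass_tendsto])
    show "\<exists>N. \<forall>n\<ge>N. dirichlet_mass (ball_set n) t x \<le> dirichlet_mass (ball_set n) s x"
      using dirichlet_mass_antimono_time[OF ball_set_finite ball_set_subset, of s "t - s" x] assms by auto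
  qed (use assms in auto)
  then show ?thesis by (simp add: defect_def)
qed

text \<open>A zero at a positive time is a minimum in time, so the time derivative and with it the
  Laplacian vanish there, and the zero spreads over \<open>V\<close>. Maximality and monotonicity of
  the defect then carry it to all times.\<close>

lemma defect_zero_everywhere:
  assumes t: "t > 0" and x: "x \<in> V" "defect t x = 0" and s: "s \<ge> 0" and y: "y \<in> V"
  shows "defect s y = 0"
proof -
  have zero: "defect t z = 0" if "z \<in> V" for z
  proof (rule vanishing_propagates[where f = "defect t", OF _ _ x that])
    fix z assume z: "z \<in> V"
    then show "defect t z \<ge> 0" using defect_nonneg t by simp
    assume 0: "defect t z = 0"
    have "- laplacian E (defect t) z = 0"
      using t z 0 defect_nonneg
      by (intro DERIV_local_min[OF solves_heat_on_deriv_at[OF defect_heat z t] t]) auto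
    then show "laplacian E (defect t) z \<ge> 0" by simp
  qed
  \<comment> \<open>Since the defect vanishes on \<open>V\<close> at time \<open>t\<close>, its
    continuation from \<open>t\<close> is again a solution with zero initial values and upper bound
    1; maximality bounds it by the defect itself.\<close>
  have step: "defect (t + r) y \<le> defect r y" if "r \<ge> 0" for r
  proof -
    have sh: "solves_heat_on V (\<lambda>r. defect (t + r))"
      using t by (intro solves_heat_on_shift defect_heat) auto
    show ?thesis
      by (rule defect_greatest[OF solves_heat_on_continuous[OF sh] solves_heat_on_deriv_at[OF sh]])
        (use zero defect_le_1 t that y in auto)
  qed
  have mult: "defect (real k * t) y = 0" for k
  proof (induction k)
    case 0
    show ?case using defect_0[OF y] by simp
  next
    case (Suc k)
    have "defect (real (Suc k) * t) y \<le> 0" using step[of "real k * t"] t Suc by (simp add: algebra_simps)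
    then show ?case using defect_nonneg[of "real (Suc k) * t" y] t y by (intro antisym) auto
  qed
  obtain k where "s \<le> real k * t"
    using reals_Archimedean3[OF t] by (meson less_imp_le)
  then have "defect s y \<le> 0" using defect_mono[OF s _ y] mult by metis
  then show ?thesis using defect_nonneg[OF s y] by simp
qed

lemma incomplete_iff_defect:
  assumes "t \<ge> 0" "x \<in> V"
  shows "heat_semigroup_one V E t x < 1 \<longleftrightarrow> defect t x > 0"
  using heat_semigroup_one_eq[OF assms] by (simp add: defect_def)

lemma defect_pos_everywhere:
  assumes "t > 0" "x \<in> V" "defect t x > 0" "s > 0" "y \<in> V"
  shows "defect s y > 0"
  using defect_zero_everywhere[of s y t x] defect_nonneg[of s y] assms by force

section \<open>Bounded eigenfunctions and subsolutions\<close>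

lemma defect_eigenfunction:
  assumes lam: "lam < 0" and pos: "\<And>t x. t > 0 \<Longrightarrow> x \<in> V \<Longrightarrow> defect t x > 0"
  shows "\<exists>v. (\<forall>x\<in>V. v x > 0) \<and> bounded (v ` V) \<and> (\<forall>x\<in>V. laplacian E v x = lam * v x)"
proof -
  \<comment> \<open>The factor \<open>- lam\<close> normalises the exponential to total mass 1 on
    the half-line, so the integrals are bounded by 1 like the defect.\<close>
  define F where "F = (\<lambda>x t. - lam * exp (lam * t) * defect t x)"
  define w where "w = (\<lambda>n x. integral {0..real n} (F x))"
  define v where "v = (\<lambda>x. lim (\<lambda>n. w n x))"
  have cont: "continuous_on {0..r} (\<lambda>t. defect t x)" if "x \<in> V" for x r
    by (rule continuous_on_subset[OF solves_heat_on_continuous[OF defect_heat that]]) auto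
  have F_cont: "continuous_on {0..r} (F x)" if "x \<in> V" for x r
    unfolding F_def by (intro continuous_intros cont that)
  have F_int: "F x integrable_on {0..r}" if "x \<in> V" for x r
    by (rule integrable_continuous_real[OF F_cont[OF that]])
  have F_nonneg: "F x t \<ge> 0" if "x \<in> V" "t \<ge> 0" for x t
    using lam defect_nonneg[OF that(2,1)] by (simp add: F_def mult_nonpos_nonneg)
  have w_mono: "w m x \<le> w n x" if "m \<le> n" "x \<in> V" for m n x
    unfolding w_def using that by (intro integral_subset_le F_int) (auto intro: F_nonneg)
  have w_le: "w n x \<le> 1" if "x \<in> V" for n x
  proof -
    have exp_int: "((\<lambda>t. - lam * exp (lam * t)) has_integral - exp (lam * real n) - - exp (lam * 0)) {0..real n}"
      by (intro fundamental_theorem_of_calculus)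
        (auto intro!: derivative_eq_intros simp flip: has_real_derivative_iff_has_vector_derivative)
    have "w n x \<le> - exp (lam * real n) - - exp (lam * 0)"
    proof (rule has_integral_le[OF _ exp_int])
      show "(F x has_integral w n x) {0..real n}"
        unfolding w_def by (rule integrable_integral[OF F_int[OF that]])
      fix t assume "t \<in> {0..real n}"
      then have "- lam * exp (lam * t) * defect t x \<le> - lam * exp (lam * t) * 1"
        using lam that by (intro mult_left_mono defect_le_1) (auto simp: mult_nonpos_nonneg)
      then show "F x t \<le> - lam * exp (lam * t)" by (simp add: F_def)
    qed
    then show ?thesis by (simp add: order_trans)
  qed
  have lim: "(\<lambda>n. w n x) \<longlonglongrightarrow> v x" if "x \<in> V" for x
    unfolding v_def using that by (intro incseq_bounded_lim[where B = 1] w_mono w_le)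
  have v_ge: "w n x \<le> v x" if "x \<in> V" for n x
    using that by (intro LIMSEQ_le_const[OF lim] exI[of _ n]) (auto intro: w_mono)
  have v_le: "v x \<le> 1" if "x \<in> V" for x
    using that by (intro LIMSEQ_le_const2[OF lim]) (auto intro: w_le)
  have v_pos: "v x > 0" if x: "x \<in> V" for x
  proof -
    \<comment> \<open>A continuous non-negative integrand with integral 0 would vanish at time 1,
      where the defect is positive.\<close>
    have "w 1 x \<noteq> 0"
    proof
      assume "w 1 x = 0"
      then have "\<forall>t\<in>{0..1}. F x t = 0"
        using integral_eq_0_iff[OF F_cont[OF x], of 1] F_nonneg[OF x] by (simp add: w_def)
      then have "F x 1 = 0" by simp
      then show False using lam pos[of 1 x] x by (simp add: F_def)
    qed
    moreover have "w 1 x \<ge> 0"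
      unfolding w_def using x by (intro integral_nonneg F_int F_nonneg) auto
    ultimately show ?thesis using v_ge[OF x, of 1] by simp
  qed
  \<comment> \<open>Integrating the derivative of \<open>exp (lam * t) * defect t x\<close>; the boundary term
    vanishes in the limit.\<close>
  have w_lap: "laplacian E (w n) x = lam * w n x + lam * (exp (lam * real n) * defect (real n) x)"
    if x: "x \<in> V" for n x
  proof -
    have "((\<lambda>t. exp (lam * t) * lam * defect t x - exp (lam * t) * laplacian E (defect t) x)
        has_integral exp (lam * real n) * defect (real n) x - exp (lam * 0) * defect 0 x) {0..real n}"
    proof (rule fundamental_theorem_of_calculus)
      fix t assume t: "t \<in> {0..real n}"
      have "((\<lambda>t. exp (lam * t) * defect t x) has_real_derivative
          exp (lam * t) * lam * defect t x - exp (lam * t) * laplacian E (defect t) x) (at t within {0..})"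
        using t by (auto intro!: derivative_eq_intros solves_heat_onD[OF defect_heat x])
      then show "((\<lambda>t. exp (lam * t) * defect t x) has_vector_derivative
          exp (lam * t) * lam * defect t x - exp (lam * t) * laplacian E (defect t) x) (at t within {0..real n})"
        unfolding has_real_derivative_iff_has_vector_derivative
        by (rule has_vector_derivative_within_subset) auto
    qed simp
    then have 1: "((\<lambda>t. lam * (exp (lam * t) * lam * defect t x - exp (lam * t) * laplacian E (defect t) x))
        has_integral lam * (exp (lam * real n) * defect (real n) x)) {0..real n}"
      using defect_0[OF x] by (intro has_integral_mult_right) simp
    have 2: "((\<lambda>t. laplacian E (\<lambda>y. F y t) x) has_integral laplacian E (w n) x) {0..real n}"
      unfolding laplacian_def w_def
      using x adj_in by (intro has_integral_sum has_integral_diff integrable_integral F_int finite_nbrs) auto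
    have 3: "((\<lambda>t. lam * F x t) has_integral lam * w n x) {0..real n}"
      unfolding w_def using x by (intro has_integral_mult_right integrable_integral F_int)
    \<comment> \<open>Because \<open>F\<close> carries the factor \<open>- lam\<close>, this
      difference is \<open>lam\<close> times the derivative of
      \<open>exp (lam * t) * defect t x\<close>.\<close>
    have eq: "(\<lambda>t. laplacian E (\<lambda>y. F y t) x - lam * F x t)
        = (\<lambda>t. lam * (exp (lam * t) * lam * defect t x - exp (lam * t) * laplacian E (defect t) x))"
      unfolding F_def laplacian_mult by (auto simp: algebra_simps)
    have "laplacian E (w n) x - lam * w n x = lam * (exp (lam * real n) * defect (real n) x)"
      using has_integral_diff[OF 2 3] 1 unfolding eq by (rule has_integral_unique)
    then show ?thesis by simp
  qed
  have "laplacian E v x = lam * v x" if x: "x \<in> V" for x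
  proof -
    have "(\<lambda>n. exp (lam * real n)) \<longlonglongrightarrow> 0"
      using lam by real_asymp
    then have "(\<lambda>n. exp (lam * real n) * defect (real n) x) \<longlonglongrightarrow> 0"
      by (rule tendsto_0_le[where K = 1])
        (use x in \<open>auto simp: abs_mult abs_of_nonneg defect_nonneg defect_le_1 mult_left_le\<close>)
    then have "(\<lambda>n. laplacian E (w n) x) \<longlonglongrightarrow> lam * v x + lam * 0"
      unfolding w_lap[OF x] by (intro tendsto_intros lim x)
    moreover have "(\<lambda>n. laplacian E (w n) x) \<longlonglongrightarrow> laplacian E v x"
      by (intro laplacian_tendsto lim x)
    ultimately show ?thesis using LIMSEQ_unique by fastforce
  qed
  moreover have "bounded (v ` V)"
    using v_le v_pos by (intro boundedI[of _ 1]) (force simp: abs_of_pos)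
  ultimately show ?thesis using v_pos by blast
qed

lemma subsolution_imp_defect:
  assumes lam: "lam < 0"
    and v: "\<And>x. x \<in> V \<Longrightarrow> v x \<ge> 0" "bounded (v ` V)" "\<And>x. x \<in> V \<Longrightarrow> laplacian E v x \<le> lam * v x"
    and x: "x \<in> V" "v x \<noteq> 0"
  shows "\<exists>t>0. defect t x > 0"
proof (rule ccontr)
  assume "\<not> (\<exists>t>0. defect t x > 0)"
  then have zero: "defect t x = 0" if "t > 0" for t
    using defect_nonneg[of t x] that x by force
  obtain M where M: "M > 0" "\<And>x. x \<in> V \<Longrightarrow> v x \<le> M"
    using v(2) by (force simp: bounded_pos)
  \<comment> \<open>Rescaling gives values in \<open>[0, 1]\<close>, so that the constant 1
    dominates at time 0.\<close>
  define b where "b = (\<lambda>x. v x / M)"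
  have b: "b z \<ge> 0" "b z \<le> 1" "laplacian E b z \<le> lam * b z" if "z \<in> V" for z
  proof -
    show "b z \<ge> 0" "b z \<le> 1" using v(1) M that by (auto simp: b_def)
    have "laplacian E b z = (1 / M) * laplacian E v z"
      using laplacian_mult[of "1 / M" v z] by (simp add: b_def)
    then show "laplacian E b z \<le> lam * b z"
      using mult_left_mono[OF v(3)[OF that], of "1 / M"] M by (simp add: b_def)
  qed
  have bx: "b x > 0" using x v(1)[of x] M by (simp add: b_def)
  \<comment> \<open>The solution growing like \<open>exp (- lam * t)\<close> from \<open>b\<close> is compared with 1 up to time \<open>T\<close>;
    outside the ball the mass defect, scaled by the maximal value \<open>exp (- lam * T)\<close>,
    dominates it.\<close>
  have main: "exp (- lam * T) * b x \<le> 1" if T: "T > 0" for T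
  proof -
    let ?m = "\<lambda>n. dirichlet_mass (ball_set n)"
    have "1 + exp (- lam * T) * (1 - ?m n T x) - exp (- lam * T) * b x \<ge> 0" for n
    proof (rule parabolic_minimum_principle[OF ball_set_finite ball_set_subset, where T = T and
          g = "\<lambda>x t. 1 + exp (- lam * T) * (1 - ?m n t x) - exp (- lam * t) * b x" and
          g' = "\<lambda>x t. exp (- lam * T) * laplacian E (?m n t) x + lam * exp (- lam * t) * b x"])
      note heat = dirichlet_mass_heat[OF ball_set_finite ball_set_subset]
      fix z assume zD: "z \<in> ball_set n"
      then have z: "z \<in> V" using ball_set_subset by auto
      have "continuous_on {0..T} (\<lambda>t. ?m n t z)"
        by (rule continuous_on_subset[OF solves_heat_on_continuous[OF heat zD]]) auto
      then show "continuous_on {0..T} (\<lambda>t. 1 + exp (- lam * T) * (1 - ?m n t z) - exp (- lam * t) * b z)"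
        by (intro continuous_intros)
      show "1 + exp (- lam * T) * (1 - ?m n 0 z) - exp (- lam * 0) * b z \<ge> 0"
        using b(2)[OF z] zD by (simp add: dirichlet_mass_0 ball_set_finite)
      fix t :: real assume t: "0 < t"
      show "((\<lambda>t. 1 + exp (- lam * T) * (1 - ?m n t z) - exp (- lam * t) * b z) has_real_derivative
          exp (- lam * T) * laplacian E (?m n t) z + lam * exp (- lam * t) * b z) (at t)"
        using t zD by (auto intro!: derivative_eq_intros solves_heat_on_deriv_at[OF heat])
      \<comment> \<open>The mass terms cancel against those in the time derivative; what remains is
        \<open>exp (- lam * t) * (lam * b z - laplacian E b z)\<close>, non-negative for a
        subsolution.\<close>
      have "laplacian E (\<lambda>y. 1 + exp (- lam * T) * (1 - ?m n t y) - exp (- lam * t) * b y) z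
          = - exp (- lam * T) * laplacian E (?m n t) z - exp (- lam * t) * laplacian E b z"
        by (simp add: laplacian_add laplacian_diff laplacian_mult laplacian_const)
      moreover have "exp (- lam * t) * laplacian E b z \<le> exp (- lam * t) * (lam * b z)"
        by (intro mult_left_mono b z) auto
      ultimately show "exp (- lam * T) * laplacian E (?m n t) z + lam * exp (- lam * t) * b z +
          laplacian E (\<lambda>y. 1 + exp (- lam * T) * (1 - ?m n t y) - exp (- lam * t) * b y) z \<ge> 0"
        by (simp add: mult_ac)
    next
      fix z t assume z: "z \<in> V - ball_set n" and t: "0 \<le> t" "t \<le> T"
      have "exp (- lam * t) * b z \<le> exp (- lam * T) * 1"
        using lam t z b by (intro mult_mono) auto
      then show "1 + exp (- lam * T) * (1 - ?m n t z) - exp (- lam * t) * b z \<ge> 0"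
        using z by (simp add: dirichlet_mass_outside)
    qed (use x T in auto)
    moreover have "(\<lambda>n. 1 + exp (- lam * T) * (1 - ?m n T x) - exp (- lam * T) * b x)
        \<longlonglongrightarrow> 1 + exp (- lam * T) * (1 - limit_mass T x) - exp (- lam * T) * b x"
      using T x by (intro tendsto_intros limit_mass_tendsto) auto
    ultimately have "1 + exp (- lam * T) * (1 - limit_mass T x) - exp (- lam * T) * b x \<ge> 0"
      by (intro LIMSEQ_le_const) auto
    then show ?thesis using zero[OF T] by (simp add: defect_def)
  qed
  \<comment> \<open>\<open>T\<close> solves \<open>exp (- lam * T) * b x = 2\<close>, which exceeds
    the bound 1 just shown; it is positive because \<open>b x \<le> 1\<close>.\<close>
  define T where "T = ln (2 / b x) / - lam"
  have "T > 0" using lam b(2)[OF x(1)] bx by (simp add: T_def divide_pos_neg)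
  moreover have "exp (- lam * T) = 2 / b x" using lam bx by (simp add: T_def)
  ultimately show False using main[of T] bx by simp
qed

text \<open>A discrete Kato inequality. With the sign \<open>s\<close> of \<open>v x\<close> frozen,
  \<open>s * v\<close> agrees with the absolute value at \<open>x\<close> and lies below it at the
  neighbours. Sign-changing eigenfunctions thus yield non-negative subsolutions.\<close>

lemma laplacian_abs_le_mult:
  assumes x: "x \<in> V" and v: "laplacian E v x = lam * v x"
  shows "laplacian E (\<lambda>y. \<bar>v y\<bar>) x \<le> lam * \<bar>v x\<bar>"
proof -
  define s where "s = (if v x \<ge> 0 then 1 else - 1 :: real)"
  have "laplacian E (\<lambda>y. \<bar>v y\<bar>) x \<le> laplacian E (\<lambda>y. s * v y) x"
    unfolding laplacian_def by (intro sum_mono) (auto simp: s_def)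
  also have "\<dots> = lam * (s * v x)" by (simp add: laplacian_mult v)
  also have "s * v x = \<bar>v x\<bar>" by (simp add: s_def)
  finally show ?thesis .
qed

lemma nonneg_subsolution_of_eigenfunction:
  assumes "\<exists>v. (\<exists>x\<in>V. v x \<noteq> 0) \<and> bounded (v ` V) \<and> (\<forall>x\<in>V. laplacian E v x = lam * v x)"
  shows "\<exists>v. (\<forall>x\<in>V. v x \<ge> 0) \<and> (\<exists>x\<in>V. v x \<noteq> 0) \<and> bounded (v ` V) \<and>
    (\<forall>x\<in>V. laplacian E v x \<le> lam * v x)"
proof -
  from assms obtain v where v: "\<exists>x\<in>V. v x \<noteq> 0" "bounded (v ` V)" "\<forall>x\<in>V. laplacian E v x = lam * v x"
    by blast
  have "bounded ((\<lambda>x. \<bar>v x\<bar>) ` V)"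
    using v(2) by (auto simp: bounded_iff)
  then show ?thesis
    using v laplacian_abs_le_mult by (intro exI[of _ "\<lambda>x. \<bar>v x\<bar>"]) auto
qed

section \<open>Bounded heat solutions with zero initial values\<close>

lemma defect_heat_solution: "heat_solution V E (\<lambda>x t. defect t x)"
  unfolding heat_solution_def
proof (intro ballI conjI allI impI)
  fix x assume x: "x \<in> V"
  note der = solves_heat_on_deriv_at[OF defect_heat x]
  show "continuous_on {0..} (\<lambda>t. defect t x)"
    by (rule solves_heat_on_continuous[OF defect_heat x])
  have "continuous_on {0<..} (\<lambda>t. - laplacian E (defect t) x)"
    by (intro continuous_on_minus laplacian_continuous x)
      (rule continuous_on_subset[OF solves_heat_on_continuous[OF defect_heat]], auto)
  then show "(\<lambda>t. defect t x) C1_differentiable_on {0<..}"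
    unfolding C1_differentiable_on_def
    using der by (auto simp: has_real_derivative_iff_has_vector_derivative intro!: exI[of _ "\<lambda>t. - laplacian E (defect t) x"])
  show "laplacian E (defect t) x + deriv (\<lambda>t. defect t x) t = 0" if "t > 0" for t
    using DERIV_imp_deriv[OF der[OF that]] by simp
qed

text \<open>Divided by a bound \<open>M\<close>, both \<open>u\<close> and \<open>- u\<close> are
  admissible in the maximality of the defect, so the defect is at least the absolute value of
  \<open>u\<close> over \<open>M\<close>.\<close>

lemma bounded_solution_imp_defect:
  assumes u: "heat_solution V E u" and init: "\<And>x. x \<in> V \<Longrightarrow> u x 0 = 0"
    and x: "x \<in> V" and t: "t \<ge> 0" and nz: "u x t \<noteq> 0"
    and bdd: "bounded {u x t | x t. x \<in> V \<and> t \<ge> 0}"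
  shows "t > 0 \<and> defect t x > 0"
proof -
  obtain M where M: "M > 0" "\<And>x t. x \<in> V \<Longrightarrow> t \<ge> 0 \<Longrightarrow> \<bar>u x t\<bar> \<le> M"
    using bdd unfolding bounded_pos by force
  have le: "c * u x t \<le> defect t x" if c: "\<bar>c\<bar> = 1 / M" for c
  proof (rule defect_greatest[where w = "\<lambda>t x. c * u x t", OF _ _ _ _ x t])
    fix z assume z: "z \<in> V"
    show "continuous_on {0..} (\<lambda>t. c * u z t)"
      using u z by (intro continuous_on_mult_left) (auto simp: heat_solution_def)
    show "c * u z 0 = 0" using init[OF z] by simp
    fix s :: real
    show "c * u z s \<le> 1" if "s \<ge> 0"
    proof -
      have "c * u z s \<le> \<bar>c\<bar> * \<bar>u z s\<bar>" by (simp flip: abs_mult)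
      also have "\<dots> \<le> 1 / M * M" unfolding c using M that z by (intro mult_left_mono) auto
      finally show ?thesis using M by simp
    qed
    assume s: "s > 0"
    \<comment> \<open>\<open>deriv\<close> has a meaning only where a derivative exists; the C1
      condition supplies its existence.\<close>
    from u z obtain D where "\<forall>s\<in>{0<..}. (u z has_vector_derivative D s) (at s)"
      by (auto simp: heat_solution_def C1_differentiable_on_def)
    then have "u z differentiable (at s)"
      using s by (auto intro: differentiableI_vector)
    then have "(u z has_real_derivative deriv (u z) s) (at s)"
      using DERIV_deriv_iff_real_differentiable by blast
    moreover have "deriv (u z) s = - laplacian E (\<lambda>y. u y s) z"
      using u z s by (force simp: heat_solution_def)
    ultimately show "((\<lambda>s. c * u z s) has_real_derivative - laplacian E (\<lambda>x. c * u x s) z) (at s)"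
      by (auto simp: laplacian_mult intro!: derivative_eq_intros)
  qed
  have "t > 0" using t nz init[OF x] by (cases "t = 0") auto
  moreover have "\<bar>u x t\<bar> / M \<le> defect t x"
    using le[of "1 / M"] le[of "- 1 / M"] M by (cases "u x t \<ge> 0") auto
  moreover have "\<bar>u x t\<bar> / M > 0" using nz M by simp
  ultimately show ?thesis by linarith
qed

end

section \<open>Assembly of the equivalences\<close>

theorem theorem3p1p3:
  fixes V :: "'a set" and E :: "'a set set" and lam :: real
  assumes "simple_graph V E"
    and "infinite V"
    and "locally_finite_graph V E"
    and "connected_graph V E"
    and "lam < 0"
  shows
    "let
       S1 = (\<exists>t>0. \<exists>x\<in>V. heat_semigroup_one V E t x < 1);
       S1' = (\<forall>t>0. \<forall>x\<in>V. heat_semigroup_one V E t x < 1);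
       S2_pos = (\<exists>v. (\<forall>x\<in>V. v x > 0) \<and> bounded (v ` V) \<and>
                     (\<forall>x\<in>V. laplacian E v x = lam * v x));
       S2_nonzero = (\<exists>v. (\<exists>x\<in>V. v x \<noteq> 0) \<and> bounded (v ` V) \<and>
                     (\<forall>x\<in>V. laplacian E v x = lam * v x));
       S2'_pos = (\<exists>v. (\<forall>x\<in>V. v x > 0) \<and> bounded (v ` V) \<and>
                     (\<forall>x\<in>V. laplacian E v x \<le> lam * v x));
       S2'_nonzero = (\<exists>v. (\<forall>x\<in>V. v x \<ge> 0) \<and> (\<exists>x\<in>V. v x \<noteq> 0) \<and> bounded (v ` V) \<and>
                     (\<forall>x\<in>V. laplacian E v x \<le> lam * v x));
       S3 = (\<exists>u. heat_solution V E u \<and> (\<forall>x\<in>V. u x 0 = 0) \<and>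
                 (\<exists>x\<in>V. \<exists>t\<ge>0. u x t \<noteq> 0) \<and>
                 bounded {u x t | x t. x \<in> V \<and> t \<ge> 0})
     in (S1 \<longleftrightarrow> S1') \<and> (S1 \<longleftrightarrow> S2_pos) \<and> (S1 \<longleftrightarrow> S2_nonzero) \<and>
        (S1 \<longleftrightarrow> S2'_pos) \<and> (S1 \<longleftrightarrow> S2'_nonzero) \<and> (S1 \<longleftrightarrow> S3)"
proof -
  obtain root where root: "root \<in> V"
    using \<open>infinite V\<close> by (metis finite.emptyI equals0I)
  interpret lfc_graph V E root
    by unfold_locales (use assms root in auto)
  define S1 where "S1 \<longleftrightarrow> (\<exists>t>0. \<exists>x\<in>V. heat_semigroup_one V E t x < 1)"
  define S1' where "S1' \<longleftrightarrow> (\<forall>t>0. \<forall>x\<in>V. heat_semigroup_one V E t x < 1)"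
  define S2_pos where "S2_pos \<longleftrightarrow> (\<exists>v. (\<forall>x\<in>V. v x > 0) \<and> bounded (v ` V) \<and>
    (\<forall>x\<in>V. laplacian E v x = lam * v x))"
  define S2_nonzero where "S2_nonzero \<longleftrightarrow> (\<exists>v. (\<exists>x\<in>V. v x \<noteq> 0) \<and> bounded (v ` V) \<and>
    (\<forall>x\<in>V. laplacian E v x = lam * v x))"
  define S2'_pos where "S2'_pos \<longleftrightarrow> (\<exists>v. (\<forall>x\<in>V. v x > 0) \<and> bounded (v ` V) \<and>
    (\<forall>x\<in>V. laplacian E v x \<le> lam * v x))"
  define S2'_nonzero where "S2'_nonzero \<longleftrightarrow> (\<exists>v. (\<forall>x\<in>V. v x \<ge> 0) \<and> (\<exists>x\<in>V. v x \<noteq> 0) \<and>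
    bounded (v ` V) \<and> (\<forall>x\<in>V. laplacian E v x \<le> lam * v x))"
  define S3 where "S3 \<longleftrightarrow> (\<exists>u. heat_solution V E u \<and> (\<forall>x\<in>V. u x 0 = 0) \<and>
    (\<exists>x\<in>V. \<exists>t\<ge>0. u x t \<noteq> 0) \<and> bounded {u x t | x t. x \<in> V \<and> t \<ge> 0})"
  have S1_iff: "S1 \<longleftrightarrow> (\<exists>t>0. \<exists>x\<in>V. defect t x > 0)"
    and S1'_iff: "S1' \<longleftrightarrow> (\<forall>t>0. \<forall>x\<in>V. defect t x > 0)"
    unfolding S1_def S1'_def using incomplete_iff_defect by (metis less_imp_le)+
  \<comment> \<open>\<open>S1'\<close> gives \<open>S1\<close> at \<open>root\<close> and time 1.
    From \<open>S1'\<close> the chain runs through \<open>S2_pos\<close>, branches over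
    \<open>S2_nonzero\<close> and \<open>S2'_pos\<close>, meets in \<open>S2'_nonzero\<close> and
    returns to \<open>S1\<close>; \<open>S3\<close> is linked to \<open>S1\<close> directly.\<close>
  have "S1 \<longleftrightarrow> S1'"
    unfolding S1_iff S1'_iff using defect_pos_everywhere root zero_less_one by metis
  moreover have "S1' \<Longrightarrow> S2_pos"
    unfolding S1'_iff S2_pos_def using defect_eigenfunction[OF \<open>lam < 0\<close>] by simp
  moreover have "S2_pos \<Longrightarrow> S2_nonzero" "S2_pos \<Longrightarrow> S2'_pos" "S2'_pos \<Longrightarrow> S2'_nonzero"
    unfolding S2_pos_def S2_nonzero_def S2'_pos_def S2'_nonzero_def
    using root by (metis less_irrefl order_refl less_imp_le)+
  moreover have "S2_nonzero \<Longrightarrow> S2'_nonzero"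
    unfolding S2_nonzero_def S2'_nonzero_def by (rule nonneg_subsolution_of_eigenfunction)
  moreover have "S2'_nonzero \<Longrightarrow> S1"
    unfolding S2'_nonzero_def S1_iff using subsolution_imp_defect[OF \<open>lam < 0\<close>] by metis
  moreover have "S3 \<Longrightarrow> S1"
    unfolding S3_def S1_iff using bounded_solution_imp_defect by blast
  moreover have "S3" if "S1"
    unfolding S3_def
  proof (intro exI[of _ "\<lambda>x t. defect t x"] conjI)
    show "heat_solution V E (\<lambda>x t. defect t x)" by (rule defect_heat_solution)
    show "\<forall>x\<in>V. defect 0 x = 0" using defect_0 by simp
    show "\<exists>x\<in>V. \<exists>t\<ge>0. defect t x \<noteq> 0" using that unfolding S1_iff by (metis less_imp_le less_irrefl)
    show "bounded {defect t x | x t. x \<in> V \<and> t \<ge> 0}"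
      by (rule boundedI[of _ 1]) (auto simp: abs_of_nonneg defect_nonneg defect_le_1)
  qed
  ultimately have "(S1 \<longleftrightarrow> S1') \<and> (S1 \<longleftrightarrow> S2_pos) \<and> (S1 \<longleftrightarrow> S2_nonzero) \<and>
      (S1 \<longleftrightarrow> S2'_pos) \<and> (S1 \<longleftrightarrow> S2'_nonzero) \<and> (S1 \<longleftrightarrow> S3)"
    by blast
  then show ?thesis
    unfolding Let_def S1_def S1'_def S2_pos_def S2_nonzero_def S2'_pos_def S2'_nonzero_def S3_def .
qed

end
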